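(* Let $P=\mathbb{C}[x_{ijk} : i,j,k\in\{0,1\}]$ with the action of $SL_2(\mathbb{C})\times SL_2(\mathbb{C})\times SL_2(\mathbb{C})$ by changes of basis of determinant $1$ along the three directions of the array $(x_{ijk})$. For every integer $d\ge 0$ with $d\equiv 0\pmod 4$, the space of invariant polynomials that are homogeneous of degree $d$ has dimension at least $1$ over $\mathbb{C}$.
   Context: The group $SL_2(\mathbb{C})^3$ acts on $P=\mathbb{C}[x_{ijk}: i,j,k\in\{0,1\}]$ by $\mathbb{C}$-algebra automorphisms: identifying $x_{ijk}$ with the simple tensor $x_i\otimes x_j\otimes x_k\in\mathbb{C}^2\otimes\mathbb{C}^2\otimes\mathbb{C}^2$ (where $x_0,x_1$ is the standard basis of $\mathbb{C}^2$, with $SL_2(\mathbb{C})$ acting by matrix-vector multiplication), a triple $(A,B,D)$ with $A=(a_{pq})$, $B=(b_{pq})$, $D=(d_{pq})$ ($p,q\in\{0,1\}$) sends $x_{ijk}\mapsto\sum_{i',j',k'\in\{0,1\}}a_{i'i}\,b_{j'j}\,d_{k'k}\,x_{i'j'k'}$, and this is extended multiplicatively and linearly to $P$. A polynomial $f\in P$ is invariant if $(A,B,D)\cdot f=f$ for all $(A,B,D)\in SL_2(\mathbb{C})^3$. *)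

theory Defs
  imports "HOL-Analysis.Analysis" "HOL-Library.Poly_Mapping"
begin

text \<open>
  Polynomials in variables of type \<open>'v\<close> are finitely supported functions from exponent
  vectors \<open>'v \<Rightarrow>\<^sub>0 nat\<close> to coefficients; their ring structure is the convolution ring
  of \<open>Poly_Mapping\<close>.
\<close>

type_synonym ('v, 'a) mpol = "('v \<Rightarrow>\<^sub>0 nat) \<Rightarrow>\<^sub>0 'a"

definition mpol_const :: "'a::zero \<Rightarrow> ('v, 'a) mpol" where
  "mpol_const c = Poly_Mapping.single 0 c"

definition mpol_var :: "'v \<Rightarrow> ('v, 'a::zero_neq_one) mpol" where
  "mpol_var v = Poly_Mapping.single (Poly_Mapping.single v 1) 1"

definition mpol_scale :: "'a::comm_semiring_1 \<Rightarrow> ('v, 'a) mpol \<Rightarrow> ('v, 'a) mpol" where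
  "mpol_scale c f = mpol_const c * f"

lemma mpol_const_add: "mpol_const (a + b) = mpol_const a + mpol_const b"
  by (simp add: mpol_const_def single_add)

lemma mpol_const_mult:
  "mpol_const (a * b) = mpol_const a * (mpol_const b :: ('v, 'a::comm_semiring_1) mpol)"
  by (simp add: mpol_const_def mult_single)

lemma mpol_const_0 [simp]: "mpol_const 0 = 0"
  by (simp add: mpol_const_def)

lemma mpol_const_1 [simp]: "mpol_const 1 = 1"
  by (simp add: mpol_const_def)

lemma lookup_mpol_scale: "Poly_Mapping.lookup (mpol_scale c f) m = c * Poly_Mapping.lookup f m"
  unfolding mpol_scale_def mpol_const_def mult_map_scale_conv_mult [symmetric]
  by (simp add: Poly_Mapping.map.rep_eq when_def)

global_interpretation mpol: vector_space
  "mpol_scale :: 'a::field \<Rightarrow> ('v, 'a) mpol \<Rightarrow> ('v, 'a) mpol"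
  by unfold_locales
    (simp_all add: mpol_scale_def mpol_const_add mpol_const_mult algebra_simps)

definition mpol_homogeneous :: "nat \<Rightarrow> ('v::finite, 'a::zero) mpol \<Rightarrow> bool" where
  "mpol_homogeneous d f \<longleftrightarrow>
    (\<forall>m\<in>Poly_Mapping.keys f. (\<Sum>v\<in>UNIV. Poly_Mapping.lookup m v) = d)"

text \<open>
  The algebra endomorphism sending each variable \<open>v\<close> to \<open>\<sigma> v\<close>
  (see \<open>mpol_subst_var\<close>, \<open>mpol_subst_const\<close>, \<open>mpol_subst_add\<close>, \<open>mpol_subst_mult\<close>).
\<close>

definition mpol_subst ::
  "('v \<Rightarrow> ('v, 'a) mpol) \<Rightarrow> ('v::finite, 'a::comm_ring_1) mpol \<Rightarrow> ('v, 'a) mpol" where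
  "mpol_subst \<sigma> f =
    (\<Sum>m\<in>Poly_Mapping.keys f. mpol_const (Poly_Mapping.lookup f m) *
      (\<Prod>v\<in>UNIV. \<sigma> v ^ Poly_Mapping.lookup m v))"

lemma mpol_subst_add: "mpol_subst \<sigma> (f + g) = mpol_subst \<sigma> f + mpol_subst \<sigma> g"
  unfolding mpol_subst_def
  by (rule setsum_keys_plus_distrib) (simp_all add: mpol_const_add distrib_right)

lemma mpol_subst_zero [simp]: "mpol_subst \<sigma> 0 = 0"
  by (simp add: mpol_subst_def)

lemma mpol_subst_single:
  "mpol_subst \<sigma> (Poly_Mapping.single m c) =
    mpol_const c * (\<Prod>v\<in>UNIV. \<sigma> v ^ Poly_Mapping.lookup m v)"
  by (simp add: mpol_subst_def)

lemma mpol_subst_const [simp]: "mpol_subst \<sigma> (mpol_const c) = mpol_const c"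
  using mpol_subst_single [of \<sigma> 0 c] by (simp add: mpol_const_def)

lemma mpol_subst_var [simp]: "mpol_subst \<sigma> (mpol_var v) = \<sigma> v"
proof -
  have "(\<Prod>w\<in>UNIV. \<sigma> w ^ Poly_Mapping.lookup (Poly_Mapping.single v 1) w)
      = (\<Prod>w\<in>UNIV. if w = v then \<sigma> w else 1)"
    by (intro prod.cong refl) (auto simp: lookup_single when_def)
  also have "\<dots> = \<sigma> v"
    by (subst prod.delta) auto
  finally show ?thesis
    by (simp add: mpol_var_def mpol_subst_single)
qed

lemma mpol_induct [case_names single add]:
  fixes f :: "'k \<Rightarrow>\<^sub>0 'a::comm_monoid_add"
  assumes "\<And>m c. P (Poly_Mapping.single m c)" and "\<And>f g. P f \<Longrightarrow> P g \<Longrightarrow> P (f + g)"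
  shows "P f"
proof -
  have "P (\<Sum>m\<in>A. Poly_Mapping.single m (Poly_Mapping.lookup f m))" if "finite A" for A
    using that
  proof induction
    case empty
    show ?case using assms(1) [of undefined 0] by simp
  next
    case (insert x A)
    then show ?case by (simp add: assms)
  qed
  moreover have "f = (\<Sum>m\<in>Poly_Mapping.keys f. Poly_Mapping.single m (Poly_Mapping.lookup f m))"
  proof (rule poly_mapping_eqI)
    fix k
    have "(\<Sum>m\<in>Poly_Mapping.keys f. Poly_Mapping.lookup (Poly_Mapping.single m (Poly_Mapping.lookup f m)) k)
        = (\<Sum>m\<in>Poly_Mapping.keys f. if m = k then Poly_Mapping.lookup f m else 0)"
      by (intro sum.cong refl) (simp add: lookup_single when_def)
    also have "\<dots> = Poly_Mapping.lookup f k"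
      by (simp add: sum.delta' in_keys_iff)
    finally show "Poly_Mapping.lookup f k =
      Poly_Mapping.lookup (\<Sum>m\<in>Poly_Mapping.keys f. Poly_Mapping.single m (Poly_Mapping.lookup f m)) k"
      by (simp add: lookup_sum)
  qed
  ultimately show ?thesis
    by (metis finite_keys)
qed

lemma mpol_subst_mult: "mpol_subst \<sigma> (f * g) = mpol_subst \<sigma> f * mpol_subst \<sigma> g"
proof (induction f rule: mpol_induct)
  case (single m a)
  show ?case
  proof (induction g rule: mpol_induct)
    case (single n b)
    show ?case
      by (simp add: mult_single mpol_subst_single lookup_add power_add prod.distrib
          mpol_const_mult mult_ac)
  next
    case (add f g)
    then show ?case by (simp add: distrib_left mpol_subst_add)
  qed
next
  case (add f g)
  then show ?case by (simp add: distrib_right mpol_subst_add)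
qed

text \<open>The type \<open>2\<close> has the two elements \<open>0\<close> and \<open>1\<close>, so that \<open>mpol_var (i, j, k)\<close> is $x_{ijk}$.\<close>

type_synonym cube_pol = "(2 \<times> 2 \<times> 2, complex) mpol"

definition SL2 :: "(complex ^ 2 ^ 2) set" where
  "SL2 = {A. det A = 1}"

definition cube_act ::
  "complex ^ 2 ^ 2 \<Rightarrow> complex ^ 2 ^ 2 \<Rightarrow> complex ^ 2 ^ 2 \<Rightarrow> cube_pol \<Rightarrow> cube_pol" where
  "cube_act A B D = mpol_subst (\<lambda>(i, j, k).
    \<Sum>i'\<in>UNIV. \<Sum>j'\<in>UNIV. \<Sum>k'\<in>UNIV.
      mpol_scale (A $ i' $ i * B $ j' $ j * D $ k' $ k) (mpol_var (i', j', k')))"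

definition cube_invariant :: "cube_pol \<Rightarrow> bool" where
  "cube_invariant f \<longleftrightarrow> (\<forall>A\<in>SL2. \<forall>B\<in>SL2. \<forall>D\<in>SL2. cube_act A B D f = f)"

definition cube_invariants :: "nat \<Rightarrow> cube_pol set" where
  "cube_invariants d = {f. cube_invariant f \<and> mpol_homogeneous d f}"

lemma subspace_cube_invariants: "mpol.subspace (cube_invariants d)"
proof (rule mpol.subspaceI)
  show "0 \<in> cube_invariants d"
    by (simp add: cube_invariants_def cube_invariant_def cube_act_def mpol_homogeneous_def)
next
  fix f g
  assume "f \<in> cube_invariants d" "g \<in> cube_invariants d"
  then show "f + g \<in> cube_invariants d"
    using keys_add [of f g]
    by (auto simp: cube_invariants_def cube_invariant_def cube_act_def mpol_homogeneous_def
        mpol_subst_add)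
next
  fix c f
  assume "f \<in> cube_invariants d"
  moreover have "Poly_Mapping.keys (mpol_scale c f) \<subseteq> Poly_Mapping.keys f"
    by (auto simp: in_keys_iff lookup_mpol_scale)
  moreover have "mpol_subst \<sigma> (mpol_scale c f) = mpol_scale c (mpol_subst \<sigma> f)" for \<sigma>
    by (simp add: mpol_scale_def mpol_subst_mult)
  ultimately show "mpol_scale c f \<in> cube_invariants d"
    by (auto simp: cube_invariants_def cube_invariant_def cube_act_def mpol_homogeneous_def)
qed

end

theory Submission
  imports Defs
begin

text \<open>
  The invariant in degree \<open>d = 4 * n\<close> is the \<open>n\<close>-th power of Cayley's hyperdeterminant. Cut the
  array \<open>y\<close> into the two slices \<open>Y\<^sub>0\<close>, \<open>Y\<^sub>1\<close> along its first direction; the hyperdeterminant is the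
  discriminant of the binary quadratic form \<open>det (s * Y\<^sub>0 + t * Y\<^sub>1)\<close> in \<open>s\<close>, \<open>t\<close>. A change of basis
  in the first direction is a linear substitution in \<open>s\<close>, \<open>t\<close>, so it multiplies the discriminant by
  the square of its determinant (\<open>hyperdet_change_basis_fst\<close>). Written out, the hyperdeterminant is
  symmetric in the three directions, so the same holds for the other two; hence it is
  \<open>SL\<^sub>2\<close>-invariant in each of them.

  All powers are nonzero because the hyperdeterminant takes the value \<open>1\<close> at the array
  with ones at \<open>(0, 0, 0)\<close> and \<open>(1, 1, 1)\<close> and zeros elsewhere.

  An invariant that is not zero gives \<open>dim \<ge> 1\<close> only once the space is known to be
  finite-dimensional, since \<open>dim\<close> is the cardinality of a basis and so vanishes for an infinite one.
  This holds because there are finitely many monomials of each degree.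
\<close>

section \<open>Homogeneous polynomials\<close>

lemma mpol_homogeneous_const: "mpol_homogeneous 0 (mpol_const c)"
  by (simp add: mpol_homogeneous_def mpol_const_def)

lemma mpol_const_numeral: "mpol_const (numeral k :: 'a::comm_semiring_1) = numeral k"
  by (simp add: mpol_const_def)

lemma mpol_homogeneous_var: "mpol_homogeneous 1 (mpol_var v)"
  by (auto simp: mpol_homogeneous_def mpol_var_def lookup_single when_def)

lemma mpol_homogeneous_add:
  "mpol_homogeneous d f \<Longrightarrow> mpol_homogeneous d g \<Longrightarrow> mpol_homogeneous d (f + g)"
  using keys_add [of f g] by (auto simp: mpol_homogeneous_def)

lemma mpol_homogeneous_diff:
  fixes f g :: "('v::finite, 'a::ab_group_add) mpol"
  shows "mpol_homogeneous d f \<Longrightarrow> mpol_homogeneous d g \<Longrightarrow> mpol_homogeneous d (f - g)"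
  using keys_diff [of f g] by (auto simp: mpol_homogeneous_def)

lemma mpol_homogeneous_mult:
  assumes "mpol_homogeneous d f" "mpol_homogeneous e g"
  shows "mpol_homogeneous (d + e) (f * g)"
  using assms keys_mult [of f g]
  by (fastforce simp: mpol_homogeneous_def lookup_add sum.distrib)

lemma mpol_homogeneous_power:
  fixes f :: "('v::finite, 'a::comm_semiring_1) mpol"
  assumes "mpol_homogeneous d f"
  shows "mpol_homogeneous (d * n) (f ^ n)"
proof (induction n)
  case 0
  show ?case using mpol_homogeneous_const [of "1 :: 'a"] by simp
next
  case (Suc n)
  show ?case using mpol_homogeneous_mult [OF assms Suc.IH] by simp
qed

lemma finite_monomials_of_degree:
  "finite {m :: 'v::finite \<Rightarrow>\<^sub>0 nat. (\<Sum>v\<in>UNIV. Poly_Mapping.lookup m v) = d}"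
proof (rule finite_imageD)
  have "Poly_Mapping.lookup m v \<le> d"
    if "(\<Sum>v\<in>UNIV. Poly_Mapping.lookup m v) = d" for m :: "'v \<Rightarrow>\<^sub>0 nat" and v
    using member_le_sum [of v UNIV "Poly_Mapping.lookup m"] that by simp
  then have "Poly_Mapping.lookup ` {m :: 'v \<Rightarrow>\<^sub>0 nat. (\<Sum>v\<in>UNIV. Poly_Mapping.lookup m v) = d}
      \<subseteq> UNIV \<rightarrow>\<^sub>E {..d}"
    by auto
  then show "finite (Poly_Mapping.lookup `
      {m :: 'v \<Rightarrow>\<^sub>0 nat. (\<Sum>v\<in>UNIV. Poly_Mapping.lookup m v) = d})"
    by (rule finite_subset) (simp add: finite_PiE)
  show "inj_on Poly_Mapping.lookup
      {m :: 'v \<Rightarrow>\<^sub>0 nat. (\<Sum>v\<in>UNIV. Poly_Mapping.lookup m v) = d}"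
    by (simp add: inj_on_def)
qed

lemma mpol_homogeneous_in_span_monomials:
  fixes f :: "('v::finite, 'a::field) mpol"
  assumes "mpol_homogeneous d f"
  shows "f \<in> mpol.span ((\<lambda>m. Poly_Mapping.single m 1) `
    {m. (\<Sum>v\<in>UNIV. Poly_Mapping.lookup m v) = d})" (is "_ \<in> mpol.span ?M")
proof -
  have "f = (\<Sum>m\<in>Poly_Mapping.keys f.
      mpol_scale (Poly_Mapping.lookup f m) (Poly_Mapping.single m 1))"
    by (rule poly_mapping_eqI)
      (simp add: lookup_sum lookup_mpol_scale lookup_single when_def if_distrib in_keys_iff
        sum.delta cong: if_cong)
  also have "\<dots> \<in> mpol.span ?M"
    using assms
    by (intro mpol.span_sum mpol.span_scale mpol.span_base) (auto simp: mpol_homogeneous_def)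
  finally show ?thesis .
qed

text \<open>
  The finite spanning set of monomials forces every basis of \<open>V\<close> to be finite, so that \<open>dim V\<close> is a
  genuine dimension and detects the nonzero element.
\<close>

lemma mpol_dim_ge_1:
  fixes V :: "('v::finite, 'a::field) mpol set"
  assumes "\<And>f. f \<in> V \<Longrightarrow> mpol_homogeneous d f" and "f \<in> V" "f \<noteq> 0"
  shows "mpol.dim V \<ge> 1"
proof -
  obtain b where b: "b \<subseteq> V" "mpol.independent b" "V \<subseteq> mpol.span b" "card b = mpol.dim V"
    by (rule mpol.basis_exists)
  have "b \<subseteq> mpol.span ((\<lambda>m. Poly_Mapping.single m 1) `
      {m. (\<Sum>v\<in>UNIV. Poly_Mapping.lookup m v) = d})"
    using b(1) assms(1) mpol_homogeneous_in_span_monomials by blast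
  then have "finite b"
    using mpol.independent_span_bound [OF _ b(2)] finite_monomials_of_degree by blast
  moreover have "b \<noteq> {}"
    using b(3) assms(2,3) by auto
  ultimately show ?thesis
    using b(4) by (metis One_nat_def Suc_leI card_gt_0_iff)
qed

section \<open>Substitution as a ring homomorphism\<close>

lemma mpol_subst_diff: "mpol_subst \<sigma> (f - g) = mpol_subst \<sigma> f - mpol_subst \<sigma> g"
  using mpol_subst_add [of \<sigma> "f - g" g] by (simp add: algebra_simps)

lemma mpol_subst_numeral: "mpol_subst \<sigma> (numeral k) = numeral k"
  by (metis mpol_const_numeral mpol_subst_const)

lemma mpol_subst_power: "mpol_subst \<sigma> (f ^ n) = mpol_subst \<sigma> f ^ n"
proof (induction n)
  case 0
  show ?case using mpol_subst_const [of \<sigma> 1] by simp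
next
  case (Suc n)
  then show ?case by (simp add: mpol_subst_mult)
qed

section \<open>Cayley's hyperdeterminant\<close>

text \<open>
  The discriminant of \<open>det (s * Y\<^sub>0 + t * Y\<^sub>1)\<close>: the square is that of the coefficient of \<open>s * t\<close>, and
  the two last factors are \<open>det Y\<^sub>0\<close> and \<open>det Y\<^sub>1\<close>. Entries in an arbitrary commutative ring
  allow the array to hold polynomials as well as scalars.
\<close>

definition hyperdet :: "(2 \<times> 2 \<times> 2 \<Rightarrow> 'a::comm_ring_1) \<Rightarrow> 'a" where
  "hyperdet y =
    (y (0,0,0) * y (1,1,1) + y (1,0,0) * y (0,1,1) - y (0,0,1) * y (1,1,0) - y (1,0,1) * y (0,1,0))\<^sup>2
    - 4 * (y (0,0,0) * y (0,1,1) - y (0,0,1) * y (0,1,0))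
        * (y (1,0,0) * y (1,1,1) - y (1,0,1) * y (1,1,0))"

text \<open>
  \<open>det_2\<close> indexes the two rows and columns by \<open>1\<close> and \<open>2\<close> instead of \<open>0\<close> and \<open>1\<close>.
\<close>

lemma two_eq_0: "(2 :: 2) = 0"
  by simp

lemma UNIV_2_eq_0_1: "(UNIV :: 2 set) = {0, 1}"
  using UNIV_2 by auto

lemma sum_UNIV_2: "(\<Sum>i\<in>(UNIV :: 2 set). f i) = f 0 + f 1"
  by (simp add: UNIV_2_eq_0_1)

lemma hyperdet_swap_fst_snd: "hyperdet (\<lambda>(i, j, k). y (j, i, k)) = hyperdet y"
  by (simp add: hyperdet_def algebra_simps power2_eq_square)

lemma hyperdet_swap_fst_trd: "hyperdet (\<lambda>(i, j, k). y (k, j, i)) = hyperdet y"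
  by (simp add: hyperdet_def algebra_simps power2_eq_square)

text \<open>
  Replacing the slices by \<open>a\<^sub>0\<^sub>0 Y\<^sub>0 + a\<^sub>1\<^sub>0 Y\<^sub>1\<close> and \<open>a\<^sub>0\<^sub>1 Y\<^sub>0 + a\<^sub>1\<^sub>1 Y\<^sub>1\<close> substitutes
  \<open>(a\<^sub>0\<^sub>0 s + a\<^sub>0\<^sub>1 t, a\<^sub>1\<^sub>0 s + a\<^sub>1\<^sub>1 t)\<close> for \<open>(s, t)\<close> in the quadratic form, and the discriminant of
  a binary quadratic form has weight two under linear substitutions.
\<close>

lemma hyperdet_change_basis_fst:
  "hyperdet (\<lambda>(i, j, k). \<Sum>i'\<in>UNIV. a i' i * y (i', j, k)) =
    (a 0 0 * a 1 1 - a 0 1 * a 1 0)\<^sup>2 * hyperdet y"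
  by (simp add: hyperdet_def sum_UNIV_2 algebra_simps power2_eq_square)

lemma hyperdet_change_basis_snd:
  "hyperdet (\<lambda>(i, j, k). \<Sum>j'\<in>UNIV. a j' j * y (i, j', k)) =
    (a 0 0 * a 1 1 - a 0 1 * a 1 0)\<^sup>2 * hyperdet y"
  using hyperdet_change_basis_fst [of a "\<lambda>(i, j, k). y (j, i, k)"]
    hyperdet_swap_fst_snd [of "\<lambda>(i, j, k). \<Sum>j'\<in>UNIV. a j' j * y (i, j', k)"]
  by (simp add: hyperdet_swap_fst_snd)

lemma hyperdet_change_basis_trd:
  "hyperdet (\<lambda>(i, j, k). \<Sum>k'\<in>UNIV. a k' k * y (i, j, k')) =
    (a 0 0 * a 1 1 - a 0 1 * a 1 0)\<^sup>2 * hyperdet y"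
  using hyperdet_change_basis_fst [of a "\<lambda>(i, j, k). y (k, j, i)"]
    hyperdet_swap_fst_trd [of "\<lambda>(i, j, k). \<Sum>k'\<in>UNIV. a k' k * y (i, j, k')"]
  by (simp add: hyperdet_swap_fst_trd)

lemma mpol_subst_hyperdet: "mpol_subst \<sigma> (hyperdet y) = hyperdet (\<lambda>v. mpol_subst \<sigma> (y v))"
  by (simp add: hyperdet_def mpol_subst_diff mpol_subst_add mpol_subst_mult mpol_subst_power
      mpol_subst_numeral)

lemma mpol_homogeneous_hyperdet:
  fixes y :: "2 \<times> 2 \<times> 2 \<Rightarrow> ('v::finite, 'a::comm_ring_1) mpol"
  assumes "\<And>v. mpol_homogeneous 1 (y v)"
  shows "mpol_homogeneous 4 (hyperdet y)"
proof -
  have quad: "mpol_homogeneous 2 (y u * y v)" for u v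
    using mpol_homogeneous_mult [OF assms assms] by (simp add: numeral_2_eq_2)
  have four: "mpol_homogeneous 0 (4 :: ('v, 'a) mpol)"
    by (metis mpol_const_numeral mpol_homogeneous_const)
  have square: "mpol_homogeneous 4 (f\<^sup>2)"
    if "mpol_homogeneous 2 f" for f :: "('v, 'a) mpol"
    using mpol_homogeneous_power [OF that, of 2] by simp
  have product: "mpol_homogeneous 4 (4 * f * g)"
    if "mpol_homogeneous 2 f" "mpol_homogeneous 2 g" for f g :: "('v, 'a) mpol"
    using mpol_homogeneous_mult [OF mpol_homogeneous_mult [OF four that(1)] that(2)]
    by (simp add: numeral_eq_Suc)
  show ?thesis
    unfolding hyperdet_def
    by (intro mpol_homogeneous_diff square product mpol_homogeneous_add quad)
qed

section \<open>Invariance and conclusion\<close>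

lemma mpol_const_SL2:
  assumes "A \<in> SL2"
  shows "mpol_const (A $ 0 $ 0) * mpol_const (A $ 1 $ 1)
    - mpol_const (A $ 0 $ 1) * mpol_const (A $ 1 $ 0) = (1 :: cube_pol)"
proof -
  have "A $ 0 $ 0 * A $ 1 $ 1 = 1 + A $ 0 $ 1 * A $ 1 $ 0"
    using assms by (simp add: SL2_def det_2 two_eq_0 algebra_simps)
  then have "mpol_const (A $ 0 $ 0) * mpol_const (A $ 1 $ 1) =
      (mpol_const (1 + A $ 0 $ 1 * A $ 1 $ 0) :: cube_pol)"
    by (simp flip: mpol_const_mult)
  then show ?thesis
    by (simp add: mpol_const_add mpol_const_mult)
qed

lemma cube_invariant_hyperdet: "cube_invariant (hyperdet mpol_var)"
  unfolding cube_invariant_def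
proof (intro ballI)
  fix A B D assume SL2: "A \<in> SL2" "B \<in> SL2" "D \<in> SL2"
  \<comment> \<open>The action is the composite of one change of basis in each direction.\<close>
  define z :: "2 \<times> 2 \<times> 2 \<Rightarrow> cube_pol" where
    "z = (\<lambda>(i, j, k). \<Sum>k'\<in>UNIV. mpol_const (D $ k' $ k) * mpol_var (i, j, k'))"
  define y where "y = (\<lambda>(i, j, k). \<Sum>j'\<in>UNIV. mpol_const (B $ j' $ j) * z (i, j', k))"
  define x where "x = (\<lambda>(i, j, k). \<Sum>i'\<in>UNIV. mpol_const (A $ i' $ i) * y (i', j, k))"
  have x_eq: "x = (\<lambda>(i, j, k). \<Sum>i'\<in>UNIV. \<Sum>j'\<in>UNIV. \<Sum>k'\<in>UNIV.
      mpol_scale (A $ i' $ i * B $ j' $ j * D $ k' $ k) (mpol_var (i', j', k')))"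
    by (simp add: x_def y_def z_def fun_eq_iff mpol_scale_def mpol_const_mult sum_distrib_left
        mult.assoc)
  have "cube_act A B D (hyperdet mpol_var) = hyperdet x"
    unfolding cube_act_def x_eq [symmetric] by (simp add: mpol_subst_hyperdet)
  also have "\<dots> = hyperdet y"
    using hyperdet_change_basis_fst [of "\<lambda>p q. mpol_const (A $ p $ q)" y]
    by (simp add: x_def mpol_const_SL2 [OF SL2(1)])
  also have "\<dots> = hyperdet z"
    using hyperdet_change_basis_snd [of "\<lambda>p q. mpol_const (B $ p $ q)" z]
    by (simp add: y_def mpol_const_SL2 [OF SL2(2)])
  also have "\<dots> = hyperdet mpol_var"
    using hyperdet_change_basis_trd [of "\<lambda>p q. mpol_const (D $ p $ q)" mpol_var]
    by (simp add: z_def mpol_const_SL2 [OF SL2(3)])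
  finally show "cube_act A B D (hyperdet mpol_var) = hyperdet mpol_var" .
qed

lemma hyperdet_power_nonzero: "hyperdet mpol_var ^ n \<noteq> (0 :: cube_pol)"
proof
  assume "hyperdet mpol_var ^ n = (0 :: cube_pol)"
  moreover define \<sigma> :: "2 \<times> 2 \<times> 2 \<Rightarrow> cube_pol" where
    "\<sigma> = (\<lambda>v. if v = (0,0,0) \<or> v = (1,1,1) then 1 else 0)"
  ultimately have "hyperdet \<sigma> ^ n = 0"
    using mpol_subst_power [of \<sigma> "hyperdet mpol_var" n] by (simp add: mpol_subst_hyperdet)
  moreover have "hyperdet \<sigma> = 1"
    by (simp add: hyperdet_def \<sigma>_def)
  ultimately show False by simp
qed

theorem corollary30:
  fixes d :: nat
  assumes "d mod 4 = 0"
  shows "mpol.dim (cube_invariants d) \<ge> 1"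
proof -
  obtain n where d: "d = 4 * n" using assms by auto
  have "cube_invariant (hyperdet mpol_var ^ n)"
    using cube_invariant_hyperdet
    by (simp add: cube_invariant_def cube_act_def mpol_subst_power)
  moreover have "mpol_homogeneous d (hyperdet mpol_var ^ n :: cube_pol)"
    unfolding d by (intro mpol_homogeneous_power mpol_homogeneous_hyperdet mpol_homogeneous_var)
  ultimately have "hyperdet mpol_var ^ n \<in> cube_invariants d"
    by (simp add: cube_invariants_def)
  then show ?thesis
    by (rule mpol_dim_ge_1 [where d = d, rotated]) (simp_all add: cube_invariants_def hyperdet_power_nonzero)
qed

end
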